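(* Let $R_{\text{OPT}}$ be the single-winner rule that assigns to each candidate $a$ the score $\sum_{i\in N_a,\ f_i\neq 1}\frac{1}{1-f_i}$ (voters who approve all candidates are ignored) and selects a candidate with the highest score, breaking ties arbitrarily. Then $R_{\text{OPT}}$ is FVR-optimal, i.e., $\mathrm{FVR}(R_{\text{OPT}},s)=1-s$ for all $s\in(0,1)$.
   Context: An (approval) instance consists of a finite non-empty set $N$ of $n$ voters, a finite non-empty set $M$ of $m$ candidates, and an approval set $A_i\subseteq M$ for each voter $i\in N$. For a candidate $a$, $N_a=\{i\in N\mid a\in A_i\}$ is the set of voters approving $a$. A single-winner rule $R$ selects, for every instance (for all $n$ and $m$), a single candidate in $M$. For a voter $i$, let $f_i=|A_i|/m$; for $s\in(0,1)$, voter $i$ is $s$-flexible if $f_i\ge s$. For a rule $R$ and $s\in(0,1)$, $\mathrm{FVR}(R,s)$ is the smallest $r\in[0,1]$ such that for every instance (over all $n$, $m$ and all approval sets), whenever a group of strictly more than $rn$ voters are all $s$-flexible, at least one voter in the group approves the candidate chosen by $R$ on that instance. (This minimum always exists.) *)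

theory Defs
  imports Complex_Main "HOL-Library.Infinite_Typeclass"
begin

record ('v, 'c) approval_instance =
  voters :: "'v set"
  candidates :: "'c set"
  approves :: "'v \<Rightarrow> 'c set"

text \<open>
  Approval sets exist only for members of the voter set; the last conjunct normalises the
  irrelevant values of the total function \<open>approves I\<close>, so that a valid record carries
  exactly the data of an instance and a rule cannot depend on anything else.
\<close>

definition valid_instance :: "('v, 'c) approval_instance \<Rightarrow> bool" where
  "valid_instance I \<longleftrightarrow>
     finite (voters I) \<and> voters I \<noteq> {} \<and>
     finite (candidates I) \<and> candidates I \<noteq> {} \<and>
     (\<forall>i\<in>voters I. approves I i \<subseteq> candidates I) \<and>
     (\<forall>i. i \<notin> voters I \<longrightarrow> approves I i = {})"

definition supporters :: "('v, 'c) approval_instance \<Rightarrow> 'c \<Rightarrow> 'v set" where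
  "supporters I a = {i \<in> voters I. a \<in> approves I i}"

definition flexibility :: "('v, 'c) approval_instance \<Rightarrow> 'v \<Rightarrow> real" where
  "flexibility I i = real (card (approves I i)) / real (card (candidates I))"

definition flexible :: "('v, 'c) approval_instance \<Rightarrow> real \<Rightarrow> 'v \<Rightarrow> bool" where
  "flexible I s i \<longleftrightarrow> flexibility I i \<ge> s"

type_synonym ('v, 'c) rule = "('v, 'c) approval_instance \<Rightarrow> 'c"

definition single_winner_rule :: "('v, 'c) rule \<Rightarrow> bool" where
  "single_winner_rule R \<longleftrightarrow> (\<forall>I. valid_instance I \<longrightarrow> R I \<in> candidates I)"

definition FVR_bound :: "('v, 'c) rule \<Rightarrow> real \<Rightarrow> real \<Rightarrow> bool" where
  "FVR_bound R s r \<longleftrightarrow>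
     (\<forall>I G. valid_instance I \<and> G \<subseteq> voters I \<and>
        real (card G) > r * real (card (voters I)) \<and> (\<forall>i\<in>G. flexible I s i)
        \<longrightarrow> (\<exists>i\<in>G. R I \<in> approves I i))"

text \<open>
  The minimum is always attained, see \<open>FVR_is_minimum\<close> below. For it to range over all numbers
  of voters and candidates, \<open>'v\<close> and \<open>'c\<close> must be infinite types.
\<close>

definition FVR :: "('v, 'c) rule \<Rightarrow> real \<Rightarrow> real" where
  "FVR R s = (LEAST r. r \<in> {0..1} \<and> FVR_bound R s r)"

definition FVR_optimal :: "('v, 'c) rule \<Rightarrow> bool" where
  "FVR_optimal R \<longleftrightarrow> (\<forall>s\<in>{0<..<1}. FVR R s = 1 - s)"

definition opt_score :: "('v, 'c) approval_instance \<Rightarrow> 'c \<Rightarrow> real" where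
  "opt_score I a =
     (\<Sum>i\<in>{i \<in> supporters I a. flexibility I i \<noteq> 1}. 1 / (1 - flexibility I i))"

text \<open>
  A predicate rather than a function: \<open>R\<close> may break ties between candidates of maximal score
  in any way.
\<close>

definition is_R_OPT :: "('v, 'c) rule \<Rightarrow> bool" where
  "is_R_OPT R \<longleftrightarrow> single_winner_rule R \<and>
     (\<forall>I. valid_instance I \<longrightarrow> (\<forall>b\<in>candidates I. opt_score I b \<le> opt_score I (R I)))"

lemma FVR_is_minimum:
  fixes R :: "('v, 'c) rule"
  shows "FVR R s \<in> {0..1} \<and> FVR_bound R s (FVR R s) \<and>
     (\<forall>r\<in>{0..1}. FVR_bound R s r \<longrightarrow> FVR R s \<le> r)"
proof -
  define S where "S = {r \<in> {0..1}. FVR_bound R s r}"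
  define m where "m = Inf S"
  have "FVR_bound R s 1"
    unfolding FVR_bound_def valid_instance_def by (auto dest: card_mono simp: not_less)
  then have ne: "1 \<in> S" by (simp add: S_def)
  have bdd: "bdd_below S" unfolding S_def by (rule bdd_belowI[of _ 0]) auto
  have m01: "0 \<le> m" "m \<le> 1"
    unfolding m_def using ne bdd by (auto intro!: cInf_greatest cInf_lower simp: S_def)
  have lower: "m \<le> r" if "r \<in> S" for r
    unfolding m_def using that bdd by (rule cInf_lower)
  have bnd: "FVR_bound R s m"
    unfolding FVR_bound_def
  proof (intro allI impI, elim conjE)
    fix I :: "('v, 'c) approval_instance" and G
    assume v: "valid_instance I" and G: "G \<subseteq> voters I" "\<forall>i\<in>G. flexible I s i"
      and c: "real (card G) > m * real (card (voters I))"
    have n: "real (card (voters I)) > 0"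
      using v by (auto simp: valid_instance_def card_gt_0_iff)
    then have "Inf S < real (card G) / real (card (voters I))"
      using c by (simp add: m_def field_simps)
    then obtain r where r: "r \<in> S" "r < real (card G) / real (card (voters I))"
      using cInf_lessD[of S] ne by blast
    then have "real (card G) > r * real (card (voters I))"
      using n by (simp add: field_simps)
    then show "\<exists>i\<in>G. R I \<in> approves I i"
      using r(1) v G unfolding S_def FVR_bound_def by blast
  qed
  have "FVR R s = m"
    unfolding FVR_def using m01 bnd lower by (intro Least_equality) (auto simp: S_def)
  then show ?thesis using m01 bnd lower by (auto simp: S_def)
qed

lemma ex_R_OPT: "\<exists>R :: ('v, 'c) rule. is_R_OPT R"
proof -
  have "\<exists>a\<in>candidates I. \<forall>b\<in>candidates I. opt_score I b \<le> opt_score I a"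
    if "valid_instance I" for I :: "('v, 'c) approval_instance"
  proof -
    have "finite (opt_score I ` candidates I)" "opt_score I ` candidates I \<noteq> {}"
      using that by (auto simp: valid_instance_def)
    from Max_in[OF this] Max_ge[OF this(1)] show ?thesis by fastforce
  qed
  then show ?thesis
    unfolding is_R_OPT_def single_winner_rule_def by metis
qed

end

theory Submission
  imports Defs
begin

text \<open>
  Upper bound: the average score of a candidate is the sum of \<open>f\<^sub>i / (1 - f\<^sub>i) = 1 / (1 - f\<^sub>i) - 1\<close>
  over the voters with \<open>f\<^sub>i \<noteq> 1\<close>. The winner scores at least that much, which says precisely that
  the weights \<open>1 / (1 - f\<^sub>i)\<close> of the counted voters who do not approve it sum to at most \<open>n\<close>;
  each \<open>s\<close>-flexible voter among them has weight at least \<open>1 / (1 - s)\<close>.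

  Lower bound, for every rule: let \<open>n = m\<close> voters approve the \<open>m\<close> cyclic intervals of
  \<open>\<lceil>s m\<rceil>\<close> candidates. All voters are \<open>s\<close>-flexible, and \<open>m - \<lceil>s m\<rceil>\<close> of them do not approve
  the winner; this fraction tends to \<open>1 - s\<close>.
\<close>

lemma flexibility_less_1:
  assumes "valid_instance I" "i \<in> voters I" "a \<in> candidates I" "a \<notin> approves I i"
  shows "flexibility I i < 1"
proof -
  have "approves I i \<subset> candidates I" "finite (candidates I)"
    using assms by (auto simp: valid_instance_def)
  then have "card (approves I i) < card (candidates I)"
    by (simp add: psubset_card_mono)
  then show ?thesis by (simp add: flexibility_def)
qed

lemma flexibility_le_1:
  assumes "valid_instance I" "i \<in> voters I"
  shows "flexibility I i \<le> 1"
proof -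
  have "card (approves I i) \<le> card (candidates I)"
    using assms by (auto simp: valid_instance_def intro: card_mono)
  then show ?thesis by (auto simp: flexibility_def divide_le_eq_1)
qed

text \<open>Double counting: each counted voter gives its weight once to every candidate in its
  approval set.\<close>

lemma sum_opt_score:
  assumes "valid_instance I"
  shows "(\<Sum>a\<in>candidates I. opt_score I a) =
    real (card (candidates I)) *
      (\<Sum>i\<in>{i \<in> voters I. flexibility I i \<noteq> 1}. 1 / (1 - flexibility I i) - 1)"
proof -
  let ?V = "{i \<in> voters I. flexibility I i \<noteq> 1}" and ?C = "candidates I"
  let ?w = "\<lambda>i. 1 / (1 - flexibility I i)"
  have fin: "finite ?V" "finite ?C" and m: "card ?C > 0"
    and sub: "\<And>i. i \<in> voters I \<Longrightarrow> approves I i \<subseteq> ?C"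
    using assms by (auto simp: valid_instance_def card_gt_0_iff)
  have "(\<Sum>a\<in>?C. opt_score I a) = (\<Sum>a\<in>?C. \<Sum>i\<in>{i \<in> ?V. a \<in> approves I i}. ?w i)"
    unfolding opt_score_def supporters_def by (intro sum.cong) auto
  also have "\<dots> = (\<Sum>i\<in>?V. \<Sum>a\<in>{a \<in> ?C. a \<in> approves I i}. ?w i)"
    using fin by (intro sum.swap_restrict)
  also have "\<dots> = (\<Sum>i\<in>?V. real (card ?C) * (?w i - 1))"
  proof (rule sum.cong)
    fix i assume i: "i \<in> ?V"
    then have "{a \<in> ?C. a \<in> approves I i} = approves I i" using sub by auto
    moreover have "real (card (approves I i)) = real (card ?C) * flexibility I i"
      using m by (simp add: flexibility_def)
    \<comment> \<open>Membership in \<open>?V\<close> excludes flexibility 1, so a nonzero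
      denominator can be cleared here.\<close>
    ultimately show "(\<Sum>a\<in>{a \<in> ?C. a \<in> approves I i}. ?w i) = real (card ?C) * (?w i - 1)"
      using i by (simp add: field_simps)
  qed simp
  finally show ?thesis by (simp add: sum_distrib_left)
qed

lemma opt_score_maximal_imp_opposition_weight_le:
  assumes I: "valid_instance I" and max: "\<And>b. b \<in> candidates I \<Longrightarrow> opt_score I b \<le> opt_score I a"
  shows "(\<Sum>i\<in>{i \<in> voters I. flexibility I i \<noteq> 1 \<and> a \<notin> approves I i}. 1 / (1 - flexibility I i))
    \<le> real (card (voters I))"
proof -
  let ?V = "{i \<in> voters I. flexibility I i \<noteq> 1}" and ?C = "candidates I"
  let ?w = "\<lambda>i. 1 / (1 - flexibility I i)"
  let ?P = "{i \<in> voters I. flexibility I i \<noteq> 1 \<and> a \<in> approves I i}"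
  let ?N = "{i \<in> voters I. flexibility I i \<noteq> 1 \<and> a \<notin> approves I i}"
  have fin: "finite (voters I)" and m: "card ?C > 0"
    using I by (auto simp: valid_instance_def card_gt_0_iff)
  \<comment> \<open>A maximal score is at least the average score; both sides are multiplied by the
    number of candidates.\<close>
  have "real (card ?C) * (\<Sum>i\<in>?V. ?w i - 1) \<le> real (card ?C) * opt_score I a"
    using sum_bounded_above[of ?C "opt_score I" "opt_score I a"] max
    by (simp add: sum_opt_score[OF I])
  then have "(\<Sum>i\<in>?V. ?w i - 1) \<le> opt_score I a" using m by simp
  also have "opt_score I a = (\<Sum>i\<in>?P. ?w i)"
    unfolding opt_score_def supporters_def by (intro sum.cong) auto
  finally have "(\<Sum>i\<in>?V. ?w i) \<le> (\<Sum>i\<in>?P. ?w i) + real (card ?V)"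
    by (simp add: sum_subtractf)
  \<comment> \<open>The weight of the supporters of \<open>a\<close> cancels. The weight of its
    opponents is left against one unit per counted voter.\<close>
  moreover have "(\<Sum>i\<in>?V. ?w i) = (\<Sum>i\<in>?P. ?w i) + (\<Sum>i\<in>?N. ?w i)"
    using fin by (subst sum.union_disjoint[symmetric]) (auto intro: sum.cong)
  moreover have "card ?V \<le> card (voters I)" using fin by (intro card_mono) auto
  ultimately show ?thesis by linarith
qed

lemma R_OPT_FVR_bound:
  assumes R: "is_R_OPT R" and s: "s < 1"
  shows "FVR_bound R s (1 - s)"
  unfolding FVR_bound_def
proof (intro allI impI, elim conjE, rule ccontr)
  fix I G
  assume I: "valid_instance I" and G: "G \<subseteq> voters I" "\<forall>i\<in>G. flexible I s i"
    and c: "(1 - s) * real (card (voters I)) < real (card G)"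
    and no: "\<not> (\<exists>i\<in>G. R I \<in> approves I i)"
  let ?w = "\<lambda>i. 1 / (1 - flexibility I i)"
  let ?N = "{i \<in> voters I. flexibility I i \<noteq> 1 \<and> R I \<notin> approves I i}"
  have a: "R I \<in> candidates I"
    and max: "\<And>b. b \<in> candidates I \<Longrightarrow> opt_score I b \<le> opt_score I (R I)"
    using R I by (auto simp: is_R_OPT_def single_winner_rule_def)
  have fin: "finite (voters I)" using I by (simp add: valid_instance_def)
  \<comment> \<open>Not approving the winner forces flexibility below 1. Hence \<open>G\<close> lies
    in \<open>?N\<close>, and on \<open>G\<close> the weights are positive and grow with
    flexibility.\<close>
  have lt: "flexibility I i < 1" if "i \<in> G" for i
    using flexibility_less_1[OF I _ a] G(1) no that by blast
  have "real (card G) * (1 / (1 - s)) \<le> (\<Sum>i\<in>G. ?w i)"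
  proof (rule sum_bounded_below)
    fix i assume "i \<in> G"
    then show "1 / (1 - s) \<le> ?w i"
      using lt[of i] G(2) by (intro divide_left_mono) (auto simp: flexible_def)
  qed
  also have "\<dots> \<le> (\<Sum>i\<in>?N. ?w i)"
  proof (rule sum_mono2)
    show "G \<subseteq> ?N" using G(1) no lt by fastforce
  qed (use fin flexibility_le_1[OF I] in auto)
  also have "\<dots> \<le> real (card (voters I))"
    using opt_score_maximal_imp_opposition_weight_le[OF I max] .
  finally show False using c s by (simp add: field_simps)
qed

lemma bij_betw_add_mod: "bij_betw (\<lambda>x. (t + x) mod m) {0..<m} {0..<m :: nat}"
proof -
  have "inj_on (\<lambda>x. (t + x) mod m) {0..<m}"
  proof (rule linorder_inj_onI)
    fix x y assume xy: "x < y" "x \<in> {0..<m}" "y \<in> {0..<m}"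
    show "(t + x) mod m \<noteq> (t + y) mod m"
    proof
      assume "(t + x) mod m = (t + y) mod m"
      \<comment> \<open>The difference equals \<open>y - x\<close>, which lies strictly between 0
        and \<open>m\<close>.\<close>
      then have "m dvd (t + y) - (t + x)" using xy(1)
        by (subst mod_eq_dvd_iff_nat[symmetric]) auto
      then show False using xy by (auto dest: dvd_imp_le)
    qed
  qed auto
  moreover have "(\<lambda>x. (t + x) mod m) ` {0..<m} \<subseteq> {0..<m}" by auto
  ultimately show ?thesis by (simp add: bij_betw_def endo_inj_surj)
qed

text \<open>Numbering by \<open>g\<close> and then rotating by \<open>t\<close> is a bijection onto
  the residues, so the preimage of \<open>{0..<k}\<close> has \<open>k\<close> elements. The set
  \<open>C\<close> is arbitrary because the count is needed for candidates and for voters.\<close>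

lemma card_cyclic_interval:
  fixes k m :: nat
  assumes g: "bij_betw g C {0..<m}" and k: "k \<le> m"
  shows "card {a \<in> C. (t + g a) mod m < k} = k"
proof -
  let ?h = "\<lambda>a. (t + g a) mod m"
  have h: "bij_betw ?h C {0..<m}"
    using bij_betw_trans[OF g bij_betw_add_mod] by (simp add: comp_def)
  then have "{0..<k} \<subseteq> ?h ` C" using k by (auto simp: bij_betw_def)
  then have "?h ` {a \<in> C. ?h a < k} = {0..<k}" by fastforce
  moreover have "inj_on ?h {a \<in> C. ?h a < k}"
    using bij_betw_imp_inj_on[OF h] by (rule inj_on_subset) blast
  ultimately show ?thesis using card_image by fastforce
qed

lemma ex_cyclic_instance:
  fixes k m :: nat
  assumes "0 < m" and k: "k \<le> m"
  shows "\<exists>I :: ('v::infinite, 'c::infinite) approval_instance. valid_instance I \<and>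
    card (voters I) = m \<and> card (candidates I) = m \<and>
    (\<forall>i\<in>voters I. card (approves I i) = k) \<and> (\<forall>a\<in>candidates I. card (supporters I a) = k)"
proof -
  obtain V :: "'v set" where V: "finite V" "card V = m"
    using infinite_arbitrarily_large[OF infinite_UNIV] by blast
  obtain C :: "'c set" where C: "finite C" "card C = m"
    using infinite_arbitrarily_large[OF infinite_UNIV] by blast
  obtain e where e: "bij_betw e V {0..<m}" using ex_bij_betw_finite_nat[OF V(1)] V(2) by blast
  obtain g where g: "bij_betw g C {0..<m}" using ex_bij_betw_finite_nat[OF C(1)] C(2) by blast
  \<comment> \<open>Voter \<open>i\<close> approves the \<open>k\<close> cyclically consecutive
    positions starting at \<open>- e i\<close> modulo \<open>m\<close>. The condition is symmetric
    in \<open>e i\<close> and \<open>g a\<close>, so the same count gives the number of supporters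
    of a candidate.\<close>
  define A where "A i = (if i \<in> V then {a \<in> C. (e i + g a) mod m < k} else {})" for i
  let ?I = "\<lparr>voters = V, candidates = C, approves = A\<rparr>"
  have "valid_instance ?I"
    using V C \<open>0 < m\<close> by (auto simp: valid_instance_def A_def)
  moreover have "card (A i) = k" if "i \<in> V" for i
    using that card_cyclic_interval[OF g k] by (simp add: A_def)
  moreover have "card (supporters ?I a) = k" if "a \<in> C" for a
  proof -
    have "supporters ?I a = {i \<in> V. (g a + e i) mod m < k}"
      using that by (auto simp: supporters_def A_def add.commute)
    then show ?thesis using card_cyclic_interval[OF e k] by simp
  qed
  ultimately show ?thesis using V C by (intro exI[of _ ?I]) simp
qed

lemma FVR_bound_imp_ge:
  fixes R :: "('v::infinite, 'c::infinite) rule"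
  assumes R: "single_winner_rule R" and s: "0 < s" "s < 1" and b: "FVR_bound R s r"
  shows "1 - s \<le> r"
proof (rule ccontr)
  assume "\<not> 1 - s \<le> r"
  then have d: "0 < 1 - s - r" by simp
  \<comment> \<open>With \<open>m\<close> this large, the slack \<open>m * (1 - s - r)\<close>
    exceeds 1, the most that rounding \<open>s * m\<close> up to an integer can cost.\<close>
  obtain m :: nat where "inverse (1 - s - r) < real m"
    using reals_Archimedean2 by blast
  then have m: "1 < real m * (1 - s - r)" and m0: "0 < m"
    using d by (auto simp: field_simps intro!: Nat.gr0I)
  \<comment> \<open>Rounding up, not down, keeps every voter \<open>s\<close>-flexible.\<close>
  define k where "k = nat \<lceil>s * real m\<rceil>"
  have k1: "s * real m \<le> real k" and k2: "real k < s * real m + 1"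
    using s(1) unfolding k_def by (auto simp: of_nat_ceiling) linarith
  have "\<lceil>s * real m\<rceil> \<le> int m" using s by (simp add: ceiling_le_iff mult_left_le_one_le)
  then have k: "k \<le> m" unfolding k_def by linarith
  obtain I :: "('v, 'c) approval_instance" where I: "valid_instance I"
    "card (voters I) = m" "card (candidates I) = m"
    "\<And>i. i \<in> voters I \<Longrightarrow> card (approves I i) = k"
    "\<And>a. a \<in> candidates I \<Longrightarrow> card (supporters I a) = k"
    using ex_cyclic_instance[OF m0 k] by blast
  \<comment> \<open>Every candidate has exactly \<open>k\<close> supporters, so the size of
    \<open>G\<close> does not depend on which one \<open>R\<close> selects.\<close>
  define G where "G = voters I - supporters I (R I)"
  have "finite (voters I)" using I(1) by (simp add: valid_instance_def)
  moreover have "R I \<in> candidates I" using R I(1) by (simp add: single_winner_rule_def)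
  ultimately have "card G = m - k"
    using I(2,5) unfolding G_def by (subst card_Diff_subset) (auto simp: supporters_def)
  \<comment> \<open>\<open>m - k > m - s * m - 1 > r * m\<close>, by \<open>k2\<close> and the
    choice of \<open>m\<close>.\<close>
  then have "r * real (card (voters I)) < real (card G)"
    using k k2 m I(2) by (simp add: algebra_simps)
  moreover have "\<forall>i\<in>G. flexible I s i"
    using I k1 m0 by (simp add: G_def flexible_def flexibility_def field_simps)
  ultimately have "\<exists>i\<in>G. R I \<in> approves I i"
    using b I(1) unfolding FVR_bound_def G_def by blast
  then show False by (auto simp: G_def supporters_def)
qed

theorem theorem2p5:
  fixes R :: "('v::infinite, 'c::infinite) rule"
  assumes "is_R_OPT R"
  shows "FVR_optimal R"
  unfolding FVR_optimal_def
proof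
  fix s :: real assume s: "s \<in> {0<..<1}"
  have "single_winner_rule R" using assms by (simp add: is_R_OPT_def)
  then show "FVR R s = 1 - s"
    unfolding FVR_def using s R_OPT_FVR_bound[OF assms] FVR_bound_imp_ge
    by (intro Least_equality) auto
qed

end
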